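(* Let $g>0$, $H>0$ and $U\in\mathbb{R}$ with $U^2=gH$ (critical flow), and let $\alpha\ge0$. Consider the semi-discrete finite volume approximation $$(I_2\otimes P)\frac{d\bar{\mathbf{q}}}{dt}+(M\otimes Q)\bar{\mathbf{q}}-\frac{\alpha}{2}(I_2\otimes A)\bar{\mathbf{q}}=\mathrm{SAT},\qquad t\ge 0,$$ with the penalty term (homogeneous boundary data) $$\mathrm{SAT}=-\frac12\left(W^{-1}SW\otimes I_{N+1}\right)\begin{bmatrix}\tau_{01}H\,\mathbf{e}_0\,\bar w_1\big|_{i=0}\\ \tau_{02}\,g\,\mathbf{e}_0\,\bar w_2\big|_{i=0}\end{bmatrix}\quad\text{if }U>0,$$ $$\mathrm{SAT}=-\frac12\left(W^{-1}SW\otimes I_{N+1}\right)\begin{bmatrix}\tau_{N1}H\,\mathbf{e}_N\,\bar w_1\big|_{i=N}\\ \tau_{N2}\,g\,\mathbf{e}_N\,\bar w_2\big|_{i=N}\end{bmatrix}\quad\text{if }U<0.$$ If the real penalty parameters are chosen such that $$\tau_{01}\ge\lambda_1,\quad\tau_{02}=0,\quad\tau_{N1}=0,\quad\tau_{N2}\ge-\lambda_2$$ (the first two being the relevant ones for $U>0$ and the last two for $U<0$), then every solution $\bar{\mathbf{q}}$ satisfies $$\frac12\frac{d}{dt}\Vert\bar{\mathbf{q}}\Vert_{WP}^2\le 0\qquad\text{for all }t\ge 0.$$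
   Context: Continuous data: $M=\begin{bmatrix}U&H\\ g&U\end{bmatrix}$, $W=\begin{bmatrix}g&0\\0&H\end{bmatrix}$, $$\lambda_{1}=\frac{1}{2gH}\left(U(g+H)+\sqrt{U^2(g+H)^2+4gH(gH-U^2)}\right),$$ $$\lambda_{2}=\frac{1}{2gH}\left(U(g+H)-\sqrt{U^2(g+H)^2+4gH(gH-U^2)}\right),$$ $$S=\begin{bmatrix}\frac1c\left(\lambda_1-\frac Ug\right)&\frac1d\left(\lambda_2-\frac Ug\right)\\ \frac1c&\frac1d\end{bmatrix},\quad c=\sqrt{\left(\lambda_1-\tfrac Ug\right)^2+1},\quad d=\sqrt{\left(\lambda_2-\tfrac Ug\right)^2+1}.$$ For critical flow, $\lambda_1>0,\lambda_2=0$ if $U>0$, and $\lambda_1=0,\lambda_2<0$ if $U<0$. Grid: $N\ge1$, nodes $0=x_0<x_1<\dots<x_N=1$, $\Delta x_i=x_i-x_{i-1}>0$, and control cell lengths $|I_0|=\Delta x_1/2$, $|I_i|=(\Delta x_i+\Delta x_{i+1})/2$ for $1\le i\le N-1$, $|I_N|=\Delta x_N/2$. Matrices of size $(N+1)\times(N+1)$ (indices $0,\dots,N$): $P=\mathrm{diag}(|I_0|,\dots,|I_N|)$. $Q$ has first row $(-\frac12,\frac12,0,\dots,0)$, last row $(0,\dots,0,-\frac12,\frac12)$, and for $1\le i\le N-1$ its row $i$ has entries $Q_{i,i-1}=-\frac12$, $Q_{i,i+1}=\frac12$ and zeros elsewhere. $A$ has first row $(-1,1,0,\dots,0)$, last row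 $(0,\dots,0,1,-1)$, and for $1\le i\le N-1$ its row $i$ has entries $A_{i,i-1}=1$, $A_{i,i}=-2$, $A_{i,i+1}=1$ and zeros elsewhere. The unknown $\bar{\mathbf{q}}(t)\in\mathbb{R}^{2(N+1)}$ collects the cell averages $\bar{\mathbf{q}}_i=[\bar h_i,\bar u_i]^\top$, ordered compatibly with the Kronecker products, i.e. $\bar{\mathbf{q}}=(\bar h_0,\dots,\bar h_N,\bar u_0,\dots,\bar u_N)^\top$. At each node $i$, $[\bar w_1,\bar w_2]^\top|_i=S^\top\bar{\mathbf{q}}_i$. $\mathbf{e}_0=(1,0,\dots,0)^\top$ and $\mathbf{e}_N=(0,\dots,0,1)^\top$ in $\mathbb{R}^{N+1}$; $I_k$ is the $k\times k$ identity and $\otimes$ the Kronecker product. The discrete norm is $\Vert\bar{\mathbf{q}}\Vert_{WP}^2=\bar{\mathbf{q}}^\top(W\otimes P)\bar{\mathbf{q}}$. *)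

theory Defs
  imports Complex_Main "Jordan_Normal_Form.Gauss_Jordan_Elimination"
begin

definition kron :: "'a :: semiring_0 mat \<Rightarrow> 'a mat \<Rightarrow> 'a mat" where
  "kron A B = mat (dim_row A * dim_row B) (dim_col A * dim_col B)
     (\<lambda>(i, j). A $$ (i div dim_row B, j div dim_col B) * B $$ (i mod dim_row B, j mod dim_col B))"

text \<open>Differentiability of a curve of vectors is componentwise, since the type of
  vectors of variable dimension carries no topology.\<close>

definition has_vec_deriv :: "(real \<Rightarrow> real vec) \<Rightarrow> real vec \<Rightarrow> nat \<Rightarrow> real filter \<Rightarrow> bool" where
  "has_vec_deriv f v n F \<longleftrightarrow>
     v \<in> carrier_vec n \<and> (\<forall>i<n. ((\<lambda>t. f t $ i) has_real_derivative v $ i) F)"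


definition Mmat :: "real \<Rightarrow> real \<Rightarrow> real \<Rightarrow> real mat" where
  "Mmat g H U = mat_of_rows_list 2 [[U, H], [g, U]]"

definition Wmat :: "real \<Rightarrow> real \<Rightarrow> real mat" where
  "Wmat g H = mat_of_rows_list 2 [[g, 0], [0, H]]"

definition lambda1 :: "real \<Rightarrow> real \<Rightarrow> real \<Rightarrow> real" where
  "lambda1 g H U = 1 / (2 * g * H) *
     (U * (g + H) + sqrt (U\<^sup>2 * (g + H)\<^sup>2 + 4 * g * H * (g * H - U\<^sup>2)))"

definition lambda2 :: "real \<Rightarrow> real \<Rightarrow> real \<Rightarrow> real" where
  "lambda2 g H U = 1 / (2 * g * H) *
     (U * (g + H) - sqrt (U\<^sup>2 * (g + H)\<^sup>2 + 4 * g * H * (g * H - U\<^sup>2)))"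

definition Smat :: "real \<Rightarrow> real \<Rightarrow> real \<Rightarrow> real mat" where
  "Smat g H U =
     (let c = sqrt ((lambda1 g H U - U / g)\<^sup>2 + 1);
          d = sqrt ((lambda2 g H U - U / g)\<^sup>2 + 1)
      in mat_of_rows_list 2
           [[1 / c * (lambda1 g H U - U / g), 1 / d * (lambda2 g H U - U / g)],
            [1 / c, 1 / d]])"


definition is_grid :: "nat \<Rightarrow> (nat \<Rightarrow> real) \<Rightarrow> bool" where
  "is_grid N x \<longleftrightarrow> N \<ge> 1 \<and> x 0 = 0 \<and> x N = 1 \<and> (\<forall>i\<in>{1..N}. x (i - 1) < x i)"

definition dx :: "(nat \<Rightarrow> real) \<Rightarrow> nat \<Rightarrow> real" where
  "dx x i = x i - x (i - 1)"

definition cell_length :: "nat \<Rightarrow> (nat \<Rightarrow> real) \<Rightarrow> nat \<Rightarrow> real" where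
  "cell_length N x i =
     (if i = 0 then dx x 1 / 2
      else if i = N then dx x N / 2
      else (dx x i + dx x (i + 1)) / 2)"

definition Pmat :: "nat \<Rightarrow> (nat \<Rightarrow> real) \<Rightarrow> real mat" where
  "Pmat N x = mat_diag (N + 1) (cell_length N x)"

definition Qmat :: "nat \<Rightarrow> real mat" where
  "Qmat N = mat (N + 1) (N + 1) (\<lambda>(i, j).
     if i = 0 then (if j = 0 then - (1 / 2) else if j = 1 then 1 / 2 else 0)
     else if i = N then (if j = N - 1 then - (1 / 2) else if j = N then 1 / 2 else 0)
     else (if j = i - 1 then - (1 / 2) else if j = i + 1 then 1 / 2 else 0))"

definition Amat :: "nat \<Rightarrow> real mat" where
  "Amat N = mat (N + 1) (N + 1) (\<lambda>(i, j).
     if i = 0 then (if j = 0 then - 1 else if j = 1 then 1 else 0)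
     else if i = N then (if j = N - 1 then 1 else if j = N then - 1 else 0)
     else (if j = i - 1 then 1 else if j = i then - 2 else if j = i + 1 then 1 else 0))"


text \<open>The state vector is ordered as \<open>(h\<^sub>0, \<dots>, h\<^sub>N, u\<^sub>0, \<dots>, u\<^sub>N)\<close>.\<close>

definition cell_state :: "nat \<Rightarrow> real vec \<Rightarrow> nat \<Rightarrow> real vec" where
  "cell_state N q i = vec_of_list [q $ i, q $ (N + 1 + i)]"

text \<open>The components \<open>w\<^sub>1, w\<^sub>2\<close> of the characteristic variables at a node have the
  vector indices \<open>0\<close> and \<open>1\<close>.\<close>

definition char_var :: "real \<Rightarrow> real \<Rightarrow> real \<Rightarrow> nat \<Rightarrow> real vec \<Rightarrow> nat \<Rightarrow> real vec" where
  "char_var g H U N q i = transpose_mat (Smat g H U) *\<^sub>v cell_state N q i"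

text \<open>\<open>SAT\<close> is only meant for \<open>U \<noteq> 0\<close>. The matrix \<open>W\<close> is invertible for \<open>g, H > 0\<close>, so
  \<open>mat_inverse\<close> then returns its inverse.\<close>

definition SAT :: "real \<Rightarrow> real \<Rightarrow> real \<Rightarrow> nat \<Rightarrow> real \<Rightarrow> real \<Rightarrow> real \<Rightarrow> real \<Rightarrow> real vec \<Rightarrow> real vec" where
  "SAT g H U N \<tau>01 \<tau>02 \<tau>N1 \<tau>N2 q =
     (- (1 / 2)) \<cdot>\<^sub>v
       (kron (the (mat_inverse (Wmat g H)) * Smat g H U * Wmat g H) (1\<^sub>m (N + 1)) *\<^sub>v
         (if U > 0
          then (\<tau>01 * H * char_var g H U N q 0 $ 0) \<cdot>\<^sub>v unit_vec (N + 1) 0 @\<^sub>v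
               (\<tau>02 * g * char_var g H U N q 0 $ 1) \<cdot>\<^sub>v unit_vec (N + 1) 0
          else (\<tau>N1 * H * char_var g H U N q N $ 0) \<cdot>\<^sub>v unit_vec (N + 1) N @\<^sub>v
               (\<tau>N2 * g * char_var g H U N q N $ 1) \<cdot>\<^sub>v unit_vec (N + 1) N))"

definition WP_norm_sq :: "real \<Rightarrow> real \<Rightarrow> nat \<Rightarrow> (nat \<Rightarrow> real) \<Rightarrow> real vec \<Rightarrow> real" where
  "WP_norm_sq g H N x q = q \<bullet> (kron (Wmat g H) (Pmat N x) *\<^sub>v q)"

end

theory Submission
  imports Defs
begin

text \<open>The matrix \<open>W M = g H [[U/H, 1], [1, U/g]]\<close> is symmetric and the columns of \<open>S\<close> are its
  eigenvectors, so multiplying the scheme by \<open>q\<^sup>T (W \<otimes> I)\<close> yields an energy balance: by summation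
  by parts \<open>Q\<close> contributes only boundary terms, \<open>A\<close> contributes a negative semidefinite form, and
  \<open>SAT\<close> contributes a multiple of the square of a characteristic variable. For critical flow
  \<open>W M\<close> has rank one, with nonzero eigenvalue of the sign of \<open>U\<close>, so the form at the outflow
  boundary is dissipative and the penalty dominates the form at the inflow boundary.\<close>

section \<open>Kronecker products acting on stacked vectors\<close>

lemma sum_lessThan_mult:
  fixes f :: "nat \<Rightarrow> 'a :: comm_monoid_add"
  shows "(\<Sum>k<r * n. f k) = (\<Sum>a<r. \<Sum>i<n. f (a * n + i))"
proof -
  have "sum f {a * n..<a * n + n} = (\<Sum>i<n. f (a * n + i))" for a
    using sum.shift_bounds_nat_ivl[of f 0 "a * n" n]
    by (simp add: atLeast0LessThan add.commute)
  then show ?thesis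
    by (simp flip: sum.nat_group)
qed

lemma kron_carrier [simp]:
  "A \<in> carrier_mat r c \<Longrightarrow> B \<in> carrier_mat m n \<Longrightarrow> kron A B \<in> carrier_mat (r * m) (c * n)"
  by (auto simp: kron_def)

text \<open>Each column index is uniquely \<open>b * n + j\<close> with \<open>j < n\<close>, so
  \<open>div\<close> and \<open>mod\<close> separate the factors: \<open>B\<close> acts inside each
  block and \<open>A\<close> combines the blocks.\<close>

lemma kron_mult_vec_index:
  fixes A B :: "'a :: comm_ring mat"
  assumes A: "A \<in> carrier_mat r c" and B: "B \<in> carrier_mat m n" and v: "v \<in> carrier_vec (c * n)"
    and "a < r" and "i < m"
  shows "(kron A B *\<^sub>v v) $ (a * m + i)
    = (\<Sum>b<c. A $$ (a, b) * (\<Sum>j<n. B $$ (i, j) * v $ (b * n + j)))"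
proof -
  have "a * m + i < r * m"
    using mult_le_mono1[of "Suc a" r m] assms(4,5) by simp
  then have "(kron A B *\<^sub>v v) $ (a * m + i)
      = (\<Sum>k<c * n. A $$ (a, k div n) * B $$ (i, k mod n) * v $ k)"
    using A B v \<open>i < m\<close> by (simp add: kron_def scalar_prod_def atLeast0LessThan)
  also have "\<dots> = (\<Sum>b<c. \<Sum>j<n. A $$ (a, b) * (B $$ (i, j) * v $ (b * n + j)))"
    by (simp add: sum_lessThan_mult mult.assoc)
  finally show ?thesis
    by (simp add: sum_distrib_left)
qed

lemma sum_lessThan_2: "(\<Sum>b<2. f b) = f 0 + f (1 :: nat)"
  by (simp add: numeral_2_eq_2)

lemma kron2_mult_vec_index:
  fixes A B :: "'a :: comm_ring mat"
  assumes "A \<in> carrier_mat 2 2" and "B \<in> carrier_mat n n" and "v \<in> carrier_vec (2 * n)" and "i < n"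
  shows "(kron A B *\<^sub>v v) $ i
      = A $$ (0, 0) * (\<Sum>j<n. B $$ (i, j) * v $ j) + A $$ (0, 1) * (\<Sum>j<n. B $$ (i, j) * v $ (n + j))"
    and "(kron A B *\<^sub>v v) $ (n + i)
      = A $$ (1, 0) * (\<Sum>j<n. B $$ (i, j) * v $ j) + A $$ (1, 1) * (\<Sum>j<n. B $$ (i, j) * v $ (n + j))"
  using kron_mult_vec_index[OF assms(1-3), of 0 i] kron_mult_vec_index[OF assms(1-3), of 1 i] assms(4)
  by (simp_all only: sum_lessThan_2 mult_0 mult_1 add_0 pos2 one_less_numeral_iff semiring_norm(76))

section \<open>Grid operators as sums over edges\<close>

lemma sum_Pmat_row: "i \<le> N \<Longrightarrow> (\<Sum>j<N + 1. Pmat N x $$ (i, j) * y j) = cell_length N x i * y i"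
proof -
  assume i: "i \<le> N"
  then have "Pmat N x $$ (i, j) * y j = (if j = i then cell_length N x i * y i else 0)"
    if "j < N + 1" for j
    using that by (auto simp: Pmat_def mat_diag_def)
  then show ?thesis
    using i by simp
qed

lemma sum_unit_row:
  fixes y :: "nat \<Rightarrow> 'a :: semiring_1"
  assumes "i < n"
  shows "(\<Sum>j<n. 1\<^sub>m n $$ (i, j) * y j) = y i"
proof -
  have "1\<^sub>m n $$ (i, j) * y j = (if j = i then y j else 0)" if "j < n" for j
    using that assms by auto
  then show ?thesis
    using assms by simp
qed

text \<open>Half differences over the edges on either side of node \<open>i\<close> treat boundary
  and interior rows uniformly; in the interior the \<open>y i\<close> terms cancel. This is the
  shape that \<open>sum_by_edges\<close> accepts.\<close>

lemma sum_Qmat_row: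
  assumes "N \<ge> 1" and "i \<le> N"
  shows "(\<Sum>j<N + 1. Qmat N $$ (i, j) * y j)
    = (if i < N then (y (i + 1) - y i) / 2 else 0) + (if i > 0 then (y i - y (i - 1)) / 2 else 0)"
proof -
  \<comment> \<open>For \<open>i = 0\<close> truncated subtraction makes \<open>j = i - 1\<close>
    coincide with \<open>j = i\<close>, hence the guard \<open>i > 0\<close>; for
    \<open>i = N\<close> the column \<open>i + 1\<close> lies outside the range of
    \<open>j\<close>.\<close>
  have "Qmat N $$ (i, j) * y j =
      (if j = i then (if i = 0 then - y i / 2 else if i = N then y i / 2 else 0) else 0)
      + (if j = i + 1 then y (i + 1) / 2 else 0)
      + (if j = i - 1 then (if i > 0 then - y (i - 1) / 2 else 0) else 0)" if "j < N + 1" for j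
    using that assms by (auto simp: Qmat_def)
  then show ?thesis
    using assms by (simp add: sum.distrib less_Suc_eq_le) (auto simp: field_simps)
qed

lemma sum_Amat_row:
  assumes "N \<ge> 1" and "i \<le> N"
  shows "(\<Sum>j<N + 1. Amat N $$ (i, j) * y j)
    = (if i < N then y (i + 1) - y i else 0) + (if i > 0 then - (y i - y (i - 1)) else 0)"
proof -
  have "Amat N $$ (i, j) * y j =
      (if j = i then (if i = 0 \<or> i = N then - y i else - 2 * y i) else 0)
      + (if j = i + 1 then y (i + 1) else 0)
      + (if j = i - 1 then (if i > 0 then y (i - 1) else 0) else 0)" if "j < N + 1" for j
    using that assms by (auto simp: Amat_def)
  then show ?thesis
    using assms by (simp add: sum.distrib less_Suc_eq_le) (auto simp: field_simps)
qed

text \<open>Regroups a sum over nodes by edges, edge \<open>i\<close> joining nodes \<open>i\<close>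
  and \<open>i + 1\<close>: \<open>d i\<close> is its contribution at the left end,
  \<open>e i\<close> at the right end.\<close>

lemma sum_by_edges:
  fixes z d e :: "nat \<Rightarrow> real"
  shows "(\<Sum>i<N + 1. z i * ((if i < N then d i else 0) + (if i > 0 then e (i - 1) else 0)))
    = (\<Sum>i<N. z i * d i + z (i + 1) * e i)"
proof -
  have "(\<Sum>i<N + 1. z i * (if i < N then d i else 0)) = (\<Sum>i<N. z i * d i)"
    by simp
  moreover have "(\<Sum>i<N + 1. z i * (if i > 0 then e (i - 1) else 0)) = (\<Sum>i<N. z (i + 1) * e i)"
    using sum.lessThan_Suc_shift[of "\<lambda>i. z i * (if i > 0 then e (i - 1) else 0)" N] by simp
  ultimately show ?thesis
    by (simp only: distrib_left sum.distrib)
qed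

text \<open>On each edge, the mean of \<open>y\<close> times the jump of \<open>z\<close>, plus the
  same with the roles exchanged, is the jump of the product. These jumps telescope to the two end
  nodes.\<close>

lemma Qmat_summation_by_parts:
  assumes "N \<ge> 1"
  shows "(\<Sum>i<N + 1. y i * (\<Sum>j<N + 1. Qmat N $$ (i, j) * z j))
       + (\<Sum>i<N + 1. z i * (\<Sum>j<N + 1. Qmat N $$ (i, j) * y j)) = y N * z N - y 0 * z 0"
proof -
  have form: "(\<Sum>i<N + 1. y i * (\<Sum>j<N + 1. Qmat N $$ (i, j) * z j))
      = (\<Sum>i<N. y i * ((z (i + 1) - z i) / 2) + y (i + 1) * ((z (i + 1) - z i) / 2))" for y z
    using sum_by_edges[of y N "\<lambda>i. (z (i + 1) - z i) / 2" "\<lambda>i. (z (i + 1) - z i) / 2"]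
    by (subst sum.cong[OF refl arg_cong[where f = "(*) (y _)", OF sum_Qmat_row[OF assms]]])
      (auto cong: if_cong)
  have "(\<Sum>i<N. y (Suc i) * z (Suc i) - y i * z i) = y N * z N - y 0 * z 0"
    by (rule sum_lessThan_telescope)
  \<comment> \<open>The discrete product rule is used in reverse: each telescoping term is replaced
    by the edge terms of the two forms.\<close>
  then show ?thesis
    unfolding form sum.distrib[symmetric]
    by (subst (asm) sum.cong[OF refl,
          where h = "\<lambda>i. y i * ((z (i + 1) - z i) / 2) + y (i + 1) * ((z (i + 1) - z i) / 2)
            + (z i * ((y (i + 1) - y i) / 2) + z (i + 1) * ((y (i + 1) - y i) / 2))"])
      (simp_all add: field_simps)
qed

text \<open>\<open>Amat N\<close> is the negative of the graph Laplacian of a path, so its quadratic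
  form is minus the sum of the squared jumps.\<close>

lemma Amat_form_nonpos:
  assumes "N \<ge> 1"
  shows "(\<Sum>i<N + 1. y i * (\<Sum>j<N + 1. Amat N $$ (i, j) * y j)) \<le> 0"
proof -
  have "(\<Sum>i<N + 1. y i * (\<Sum>j<N + 1. Amat N $$ (i, j) * y j))
      = (\<Sum>i<N. y i * (y (i + 1) - y i) + y (i + 1) * (- (y (i + 1) - y i)))"
    using sum_by_edges[of y N "\<lambda>i. y (i + 1) - y i" "\<lambda>i. - (y (i + 1) - y i)"]
    by (subst sum.cong[OF refl arg_cong[where f = "(*) (y _)", OF sum_Amat_row[OF assms]]])
      (auto cong: if_cong)
  also have "\<dots> = - (\<Sum>i<N. (y (i + 1) - y i)\<^sup>2)"
    by (simp add: sum_negf[symmetric] power2_eq_square algebra_simps)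
  finally show ?thesis
    by (simp add: sum_nonneg)
qed

section \<open>The penalty term and its energy\<close>

lemma Wmat_carrier [simp]: "Wmat g H \<in> carrier_mat 2 2"
  and Mmat_carrier [simp]: "Mmat g H U \<in> carrier_mat 2 2"
  and Smat_carrier [simp]: "Smat g H U \<in> carrier_mat 2 2"
  and Pmat_carrier [simp]: "Pmat N x \<in> carrier_mat (N + 1) (N + 1)"
  and Qmat_carrier [simp]: "Qmat N \<in> carrier_mat (N + 1) (N + 1)"
  and Amat_carrier [simp]: "Amat N \<in> carrier_mat (N + 1) (N + 1)"
  by (simp_all add: Wmat_def Mmat_def Smat_def Let_def Pmat_def Qmat_def Amat_def
      mat_of_rows_list_def numeral_2_eq_2)

lemma mat_inverse_Wmat:
  assumes "g > 0" and "H > 0"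
  shows "the (mat_inverse (Wmat g H)) = mat_of_rows_list 2 [[1 / g, 0], [0, 1 / H]]"
proof -
  let ?V = "mat_of_rows_list 2 [[1 / g, 0], [0, 1 / H]]"
  have V: "?V \<in> carrier_mat 2 2"
    by (simp add: mat_of_rows_list_def numeral_2_eq_2)
  have WV: "Wmat g H * ?V = 1\<^sub>m 2" and VW: "?V * Wmat g H = 1\<^sub>m 2"
    using assms
    by (auto intro!: eq_matI
        simp: Wmat_def mat_of_rows_list_def scalar_prod_def less_2_cases_iff sum_lessThan_2 atLeast0LessThan)
  \<comment> \<open>A two-sided inverse makes the matrix a unit of the matrix ring, which rules out
    the result \<open>None\<close>; what follows is the uniqueness of inverses.\<close>
  have "Wmat g H \<in> Units (ring_mat TYPE(real) 2 b)" for b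
    using WV VW V by (auto simp: Units_def ring_mat_def)
  then obtain B where B: "mat_inverse (Wmat g H) = Some B"
    using mat_inverse(1)[OF Wmat_carrier] by (metis option.exhaust)
  have "B = B * (Wmat g H * ?V)"
    using mat_inverse(2)[OF Wmat_carrier B] right_mult_one_mat[of B 2 2] by (simp add: WV)
  also have "\<dots> = B * Wmat g H * ?V"
    using mat_inverse(2)[OF Wmat_carrier B] V
    by (intro assoc_mult_mat[symmetric, where ?n\<^sub>1 = 2 and ?n\<^sub>2 = 2 and ?n\<^sub>3 = 2 and ?n\<^sub>4 = 2]) auto
  also have "\<dots> = ?V"
    using mat_inverse(2)[OF Wmat_carrier B] V by simp
  finally show ?thesis
    by (simp add: B)
qed

lemma SAT_matrix_carrier:
  assumes "g > 0" and "H > 0"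
  shows "the (mat_inverse (Wmat g H)) * Smat g H U * Wmat g H \<in> carrier_mat 2 2"
  unfolding mat_inverse_Wmat[OF assms]
  by (auto simp: mat_of_rows_list_def intro!: mult_carrier_mat[where n = 2])

lemma SAT_matrix_index:
  fixes g H U :: real
  assumes "g > 0" and "H > 0"
  defines "T \<equiv> the (mat_inverse (Wmat g H)) * Smat g H U * Wmat g H"
  shows "T $$ (0, 0) = Smat g H U $$ (0, 0)" "T $$ (0, 1) = Smat g H U $$ (0, 1) * H / g"
    "T $$ (1, 0) = Smat g H U $$ (1, 0) * g / H" "T $$ (1, 1) = Smat g H U $$ (1, 1)"
  using assms(1,2) carrier_matD[OF Smat_carrier[of g H U]]
  unfolding T_def mat_inverse_Wmat[OF assms(1,2)]
  by (simp_all add: Wmat_def mat_of_rows_list_def scalar_prod_def sum_lessThan_2 atLeast0LessThan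
      numeral_2_eq_2)

lemma char_var_index:
  "char_var g H U N q i $ 0 = Smat g H U $$ (0, 0) * q $ i + Smat g H U $$ (1, 0) * q $ (N + 1 + i)"
  "char_var g H U N q i $ 1 = Smat g H U $$ (0, 1) * q $ i + Smat g H U $$ (1, 1) * q $ (N + 1 + i)"
  using carrier_matD[OF Smat_carrier[of g H U]]
  by (simp_all add: char_var_def cell_state_def scalar_prod_def numeral_2_eq_2 vec_of_list_index)

text \<open>The weights \<open>g\<close> and \<open>H\<close> cancel the inverse of W in
  \<open>SAT\<close>. What remains is the pairing of the characteristic variables (the transpose of
  S applied to the state) with W times the penalty data, and both components of it acquire the same
  factor \<open>g * H\<close>.\<close>

lemma SAT_energy:
  assumes "g > 0" and "H > 0"
  shows "(\<Sum>i<N + 1. g * q $ i * SAT g H U N \<tau>01 \<tau>02 \<tau>N1 \<tau>N2 q $ i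
       + H * q $ (N + 1 + i) * SAT g H U N \<tau>01 \<tau>02 \<tau>N1 \<tau>N2 q $ (N + 1 + i))
    = - (g * H / 2) *
      (if U > 0 then \<tau>01 * (char_var g H U N q 0 $ 0)\<^sup>2 + \<tau>02 * (char_var g H U N q 0 $ 1)\<^sup>2
       else \<tau>N1 * (char_var g H U N q N $ 0)\<^sup>2 + \<tau>N2 * (char_var g H U N q N $ 1)\<^sup>2)"
proof -
  let ?T = "the (mat_inverse (Wmat g H)) * Smat g H U * Wmat g H"
  \<comment> \<open>\<open>k\<close> is the node that carries the penalty, so both branches of
    \<open>SAT\<close> are treated at once.\<close>
  define k where "k = (if U > 0 then 0 else N)"
  define \<tau>1 where "\<tau>1 = (if U > 0 then \<tau>01 else \<tau>N1)"
  define \<tau>2 where "\<tau>2 = (if U > 0 then \<tau>02 else \<tau>N2)"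
  let ?w = "char_var g H U N q k"
  let ?v = "(\<tau>1 * H * ?w $ 0) \<cdot>\<^sub>v unit_vec (N + 1) k @\<^sub>v (\<tau>2 * g * ?w $ 1) \<cdot>\<^sub>v unit_vec (N + 1) k"
  have k: "k < N + 1"
    by (simp add: k_def)
  have SAT_eq: "SAT g H U N \<tau>01 \<tau>02 \<tau>N1 \<tau>N2 q = (- (1 / 2)) \<cdot>\<^sub>v (kron ?T (1\<^sub>m (N + 1)) *\<^sub>v ?v)"
    by (simp add: SAT_def k_def \<tau>1_def \<tau>2_def)
  have v: "?v \<in> carrier_vec (2 * (N + 1))"
    unfolding mult_2 by (intro append_carrier_vec smult_carrier_vec) auto
  note T = SAT_matrix_carrier[OF assms, of U]
  have dim: "dim_row (kron ?T (1\<^sub>m (N + 1))) = 2 * (N + 1)"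
    using kron_carrier[OF T one_carrier_mat] by blast
  \<comment> \<open>The unit vectors localize the energy at node \<open>k\<close>; there the mixed
    products complete the squares of the characteristic variables.\<close>
  have "g * q $ i * SAT g H U N \<tau>01 \<tau>02 \<tau>N1 \<tau>N2 q $ i
       + H * q $ (N + 1 + i) * SAT g H U N \<tau>01 \<tau>02 \<tau>N1 \<tau>N2 q $ (N + 1 + i)
     = (if i = k then - (g * H / 2) * (\<tau>1 * (?w $ 0)\<^sup>2 + \<tau>2 * (?w $ 1)\<^sup>2) else 0)"
    if i: "i < N + 1" for i
  proof -
    have v1: "?v $ i = (if i = k then \<tau>1 * H * ?w $ 0 else 0)"
      and v2: "?v $ (N + 1 + i) = (if i = k then \<tau>2 * g * ?w $ 1 else 0)"
      using i k by (auto simp: unit_vec_def)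
    have s1: "SAT g H U N \<tau>01 \<tau>02 \<tau>N1 \<tau>N2 q $ i
        = - (1 / 2) * (?T $$ (0, 0) * ?v $ i + ?T $$ (0, 1) * ?v $ (N + 1 + i))"
      unfolding SAT_eq
      by (subst index_smult_vec)
        (use i dim kron2_mult_vec_index(1)[OF T one_carrier_mat v i] in
          \<open>simp_all only: sum_unit_row[OF i] dim_mult_mat_vec, simp_all\<close>)
    have s2: "SAT g H U N \<tau>01 \<tau>02 \<tau>N1 \<tau>N2 q $ (N + 1 + i)
        = - (1 / 2) * (?T $$ (1, 0) * ?v $ i + ?T $$ (1, 1) * ?v $ (N + 1 + i))"
      unfolding SAT_eq
      by (subst index_smult_vec)
        (use i dim kron2_mult_vec_index(2)[OF T one_carrier_mat v i] in
          \<open>simp_all only: sum_unit_row[OF i] dim_mult_mat_vec, simp_all\<close>)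
    show ?thesis
      unfolding s1 s2 v1 v2 SAT_matrix_index[OF assms]
      unfolding char_var_index using assms by (simp add: field_simps power2_eq_square)
  qed
  then have "(\<Sum>i<N + 1. g * q $ i * SAT g H U N \<tau>01 \<tau>02 \<tau>N1 \<tau>N2 q $ i
       + H * q $ (N + 1 + i) * SAT g H U N \<tau>01 \<tau>02 \<tau>N1 \<tau>N2 q $ (N + 1 + i))
     = - (g * H / 2) * (\<tau>1 * (?w $ 0)\<^sup>2 + \<tau>2 * (?w $ 1)\<^sup>2)"
    using k by simp
  then show ?thesis
    by (simp add: k_def \<tau>1_def \<tau>2_def)
qed

section \<open>Boundary forms for critical flow\<close>

lemma critical_sqrt:
  assumes "g > 0" and "H > 0" and "U\<^sup>2 = g * H"
  shows "sqrt (U\<^sup>2 * (g + H)\<^sup>2 + 4 * g * H * (g * H - U\<^sup>2)) = \<bar>U\<bar> * (g + H)"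
  using assms by (simp add: real_sqrt_mult flip: real_sqrt_abs[of U])

text \<open>For the given sign of \<open>U\<close> the root reinforces the linear term and doubles
  it, so this is the nonzero one of the two values.\<close>

lemma critical_lambda:
  assumes "g > 0" and "H > 0" and "U\<^sup>2 = g * H"
  shows "U > 0 \<Longrightarrow> lambda1 g H U = U * (g + H) / (g * H)"
    and "U < 0 \<Longrightarrow> lambda2 g H U = U * (g + H) / (g * H)"
  using assms(1,2) unfolding lambda1_def lambda2_def critical_sqrt[OF assms]
  by (simp_all add: field_simps)

text \<open>The left side is the quadratic form of W M, whose determinant
  \<open>g * H * (U\<^sup>2 - g * H)\<close> vanishes. Its only nonzero eigenvalue is therefore the
  trace \<open>U * (g + H)\<close>, which is \<open>g * H * l\<close>, and the square projects onto
  the normalized eigenvector along \<open>(U / H, 1)\<close>.\<close>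

lemma rank_one_form:
  fixes g H U a b :: real
  assumes "g > 0" and "H > 0" and "U\<^sup>2 = g * H" and l: "l = U * (g + H) / (g * H)"
  shows "g * U * a\<^sup>2 + 2 * g * H * a * b + H * U * b\<^sup>2
    = g * H * l * (1 / sqrt ((l - U / g)\<^sup>2 + 1) * (l - U / g) * a + 1 / sqrt ((l - U / g)\<^sup>2 + 1) * b)\<^sup>2"
proof -
  have m: "l - U / g = U / H"
    using assms(1,2) by (simp add: l field_simps)
  \<comment> \<open>Criticality gives \<open>(U / H)\<^sup>2 = g / H\<close>, so the normalization
    cancels the factor \<open>g + H\<close> of the eigenvalue.\<close>
  have pos: "(U / H)\<^sup>2 + 1 = (g + H) / H"
    using assms by (simp add: power_divide field_simps power2_eq_square)
  define c where "c = sqrt ((U / H)\<^sup>2 + 1)"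
  have c: "c\<^sup>2 = (g + H) / H" "c \<noteq> 0"
    using assms(1,2) by (auto simp: c_def pos)
  have "g * H * l * (1 / c * (U / H) * a + 1 / c * b)\<^sup>2 = g * H * l * (U / H * a + b)\<^sup>2 / c\<^sup>2"
    using c(2) by (simp add: power2_eq_square field_simps)
  also have "\<dots> = H * U * (U / H * a + b)\<^sup>2"
  proof -
    have "g * H * l = U * (g + H)" and "g + H \<noteq> 0"
      using assms(1,2) by (simp_all add: l)
    then show ?thesis
      unfolding c(1) by simp
  qed
  also have "\<dots> = U * (U\<^sup>2 / H * a\<^sup>2 + 2 * U * a * b + H * b\<^sup>2)"
    using assms(1,2) by (simp add: power2_eq_square field_simps)
  also have "\<dots> = g * U * a\<^sup>2 + 2 * U\<^sup>2 * a * b + H * U * b\<^sup>2"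
    using assms(2) unfolding assms(3)
    by (simp add: power2_eq_square algebra_simps assms(3)[unfolded power2_eq_square])
  finally show ?thesis
    by (simp add: m c_def assms(3))
qed

text \<open>The eigenvector for the nonzero eigenvalue is the first column of S if
  \<open>U > 0\<close> and the second if \<open>U < 0\<close>, so a single characteristic variable
  survives.\<close>

lemma critical_form:
  fixes g H U :: real and N :: nat
  assumes "g > 0" and "H > 0" and "U\<^sup>2 = g * H"
  defines "F \<equiv> \<lambda>q i. g * U * (q $ i)\<^sup>2 + 2 * g * H * q $ i * q $ (N + 1 + i) + H * U * (q $ (N + 1 + i))\<^sup>2"
  shows "U > 0 \<Longrightarrow> F q i = g * H * lambda1 g H U * (char_var g H U N q i $ 0)\<^sup>2"
    and "U < 0 \<Longrightarrow> F q i = g * H * lambda2 g H U * (char_var g H U N q i $ 1)\<^sup>2"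
  unfolding F_def char_var_index
  using rank_one_form[OF assms(1-3) critical_lambda(1)[OF assms(1-3)], of "q $ i" "q $ (N + 1 + i)"]
    rank_one_form[OF assms(1-3) critical_lambda(2)[OF assms(1-3)], of "q $ i" "q $ (N + 1 + i)"]
  by (simp_all add: Smat_def Let_def mat_of_rows_list_def)

text \<open>The outflow node has the dissipative sign by itself; at the inflow node the penalty
  parameter is at least the modulus of the nonzero eigenvalue and absorbs the growth.\<close>

lemma boundary_terms_nonpos:
  fixes g H U :: real and N :: nat and q :: "real vec"
  assumes gH: "g > 0" "H > 0" "U\<^sup>2 = g * H"
    and "U > 0 \<Longrightarrow> \<tau>01 \<ge> lambda1 g H U \<and> \<tau>02 = 0"
    and "U < 0 \<Longrightarrow> \<tau>N1 = 0 \<and> \<tau>N2 \<ge> - lambda2 g H U"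
  defines "F \<equiv> \<lambda>i. g * U * (q $ i)\<^sup>2 + 2 * g * H * q $ i * q $ (N + 1 + i) + H * U * (q $ (N + 1 + i))\<^sup>2"
  shows "(F 0 - F N) / 2
    + (\<Sum>i<N + 1. g * q $ i * SAT g H U N \<tau>01 \<tau>02 \<tau>N1 \<tau>N2 q $ i
       + H * q $ (N + 1 + i) * SAT g H U N \<tau>01 \<tau>02 \<tau>N1 \<tau>N2 q $ (N + 1 + i)) \<le> 0"
proof -
  \<comment> \<open>Since \<open>g * H > 0\<close>, critical flow excludes
    \<open>U = 0\<close>.\<close>
  consider "U > 0" | "U < 0"
    using gH by (metis linorder_neqE_linordered_idom mult_pos_pos less_irrefl zero_power2)
  then show ?thesis
  proof cases
    case 1
    let ?w = "\<lambda>i. (char_var g H U N q i $ 0)\<^sup>2"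
    \<comment> \<open>This quantity is \<open>- 2\<close> times the left side of the claim.\<close>
    have "0 \<le> g * H * ((\<tau>01 - lambda1 g H U) * ?w 0 + lambda1 g H U * ?w N)"
      using assms(4)[OF 1] gH(1,2) 1 critical_lambda(1)[OF gH 1] by simp
    then show ?thesis
      unfolding F_def critical_form(1)[OF gH 1] SAT_energy[OF gH(1,2)]
      using assms(4)[OF 1] 1 by (simp add: field_simps)
  next
    case 2
    let ?w = "\<lambda>i. (char_var g H U N q i $ 1)\<^sup>2"
    have "lambda2 g H U \<le> 0"
      using gH(1,2) 2 critical_lambda(2)[OF gH 2] by (simp add: divide_nonpos_pos mult_nonpos_nonneg)
    then have "0 \<le> (\<tau>N2 + lambda2 g H U) * ?w N" and "0 \<le> (- lambda2 g H U) * ?w 0"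
      using assms(5)[OF 2] by (auto intro!: mult_nonneg_nonneg mult_nonpos_nonneg)
    then have "0 \<le> g * H * ((\<tau>N2 + lambda2 g H U) * ?w N + (- lambda2 g H U) * ?w 0)"
      using gH(1,2) by (meson add_nonneg_nonneg less_imp_le mult_nonneg_nonneg)
    then show ?thesis
      unfolding F_def critical_form(2)[OF gH 2] SAT_energy[OF gH(1,2)]
      using assms(5)[OF 2] 2 by (simp add: field_simps)
  qed
qed

section \<open>The energy balance\<close>

lemma WP_norm_sq_eq:
  assumes "q \<in> carrier_vec (2 * (N + 1))"
  shows "WP_norm_sq g H N x q
    = (\<Sum>i<N + 1. cell_length N x i * (g * (q $ i)\<^sup>2 + H * (q $ (N + 1 + i))\<^sup>2))"
proof -
  have W: "Wmat g H $$ (0, 0) = g" "Wmat g H $$ (0, 1) = 0"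
    "Wmat g H $$ (1, 0) = 0" "Wmat g H $$ (1, 1) = H"
    by (simp_all add: Wmat_def mat_of_rows_list_def)
  have "dim_vec (kron (Wmat g H) (Pmat N x) *\<^sub>v q) = 2 * (N + 1)"
    using kron_carrier[OF Wmat_carrier Pmat_carrier] by (metis carrier_matD(1) dim_mult_mat_vec)
  then have "WP_norm_sq g H N x q = (\<Sum>i<N + 1. q $ i * (kron (Wmat g H) (Pmat N x) *\<^sub>v q) $ i
      + q $ (N + 1 + i) * (kron (Wmat g H) (Pmat N x) *\<^sub>v q) $ (N + 1 + i))"
    unfolding WP_norm_sq_def scalar_prod_def
    by (simp only: atLeast0LessThan sum_lessThan_mult sum_lessThan_2 sum.distrib mult_0 mult_1 add_0)
  also have "\<dots> = (\<Sum>i<N + 1. cell_length N x i * (g * (q $ i)\<^sup>2 + H * (q $ (N + 1 + i))\<^sup>2))"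
  proof (rule sum.cong[OF refl])
    fix i assume "i \<in> {..<N + 1}"
    then have i: "i < N + 1" by simp
    then have "i \<le> N" by simp
    show "q $ i * (kron (Wmat g H) (Pmat N x) *\<^sub>v q) $ i
        + q $ (N + 1 + i) * (kron (Wmat g H) (Pmat N x) *\<^sub>v q) $ (N + 1 + i)
      = cell_length N x i * (g * (q $ i)\<^sup>2 + H * (q $ (N + 1 + i))\<^sup>2)"
      unfolding kron2_mult_vec_index[OF Wmat_carrier Pmat_carrier assms i] W
        sum_Pmat_row[OF \<open>i \<le> N\<close>]
      by (simp add: algebra_simps power2_eq_square)
  qed
  finally show ?thesis .
qed

text \<open>Purely algebraic core at a fixed time: \<open>dq\<close> is any vector tied to
  \<open>q\<close> by the scheme, and the sum is half the derivative of the squared norm when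
  \<open>dq\<close> is the derivative of \<open>q\<close>.\<close>

lemma energy_rate_nonpos:
  assumes gH: "g > 0" "H > 0" "U\<^sup>2 = g * H" and "\<alpha> \<ge> 0" and N: "N \<ge> 1"
    and q: "q \<in> carrier_vec (2 * (N + 1))" and dq: "dq \<in> carrier_vec (2 * (N + 1))"
    and scheme: "kron (1\<^sub>m 2) (Pmat N x) *\<^sub>v dq + kron (Mmat g H U) (Qmat N) *\<^sub>v q
      - (\<alpha> / 2) \<cdot>\<^sub>v (kron (1\<^sub>m 2) (Amat N) *\<^sub>v q) = SAT g H U N \<tau>01 \<tau>02 \<tau>N1 \<tau>N2 q"
    and penalty: "U > 0 \<Longrightarrow> \<tau>01 \<ge> lambda1 g H U \<and> \<tau>02 = 0"
      "U < 0 \<Longrightarrow> \<tau>N1 = 0 \<and> \<tau>N2 \<ge> - lambda2 g H U"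
  shows "(\<Sum>i<N + 1. cell_length N x i * (g * q $ i * dq $ i + H * q $ (N + 1 + i) * dq $ (N + 1 + i))) \<le> 0"
proof -
  let ?s = "SAT g H U N \<tau>01 \<tau>02 \<tau>N1 \<tau>N2 q"
  let ?F = "\<lambda>i. g * U * (q $ i)\<^sup>2 + 2 * g * H * q $ i * q $ (N + 1 + i) + H * U * (q $ (N + 1 + i))\<^sup>2"
  define h where "h = (\<lambda>i. q $ i)"
  define u where "u = (\<lambda>i. q $ (N + 1 + i))"
  define Q where "Q = (\<lambda>y i. \<Sum>j<N + 1. Qmat N $$ (i, j) * y j)"
  define A where "A = (\<lambda>y i. \<Sum>j<N + 1. Amat N $$ (i, j) * y j)"
  define B where "B = (\<lambda>y z. \<Sum>i<N + 1. y i * Q z i)"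
  define C where "C = (\<lambda>y. \<Sum>i<N + 1. y i * A y i)"
  have M: "Mmat g H U $$ (0, 0) = U" "Mmat g H U $$ (0, 1) = H"
    "Mmat g H U $$ (1, 0) = g" "Mmat g H U $$ (1, 1) = U"
    by (simp_all add: Mmat_def mat_of_rows_list_def)
  have I: "1\<^sub>m 2 $$ (0, 0) = (1 :: real)" "1\<^sub>m 2 $$ (0, 1) = (0 :: real)"
    "1\<^sub>m 2 $$ (1, 0) = (0 :: real)" "1\<^sub>m 2 $$ (1, 1) = (1 :: real)"
    by simp_all
  have dims: "dim_row (kron (1\<^sub>m 2) (Pmat N x)) = 2 * (N + 1)"
    "dim_row (kron (Mmat g H U) (Qmat N)) = 2 * (N + 1)"
    "dim_row (kron (1\<^sub>m 2) (Amat N)) = 2 * (N + 1)"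
    using kron_carrier[OF one_carrier_mat Pmat_carrier, of 2 N x]
      kron_carrier[OF Mmat_carrier Qmat_carrier, of g H U N]
      kron_carrier[OF one_carrier_mat Amat_carrier, of 2 N] by blast+
  have comp: "?s $ k = (kron (1\<^sub>m 2) (Pmat N x) *\<^sub>v dq) $ k + (kron (Mmat g H U) (Qmat N) *\<^sub>v q) $ k
      - \<alpha> / 2 * (kron (1\<^sub>m 2) (Amat N) *\<^sub>v q) $ k" if "k < 2 * (N + 1)" for k
    unfolding scheme[symmetric] using that dims
    by (simp del: index_mult_mat_vec)
  \<comment> \<open>The two scheme rows of node \<open>i\<close> are weighted by
    \<open>g * h i\<close> and \<open>H * u i\<close>, that is, by W applied to the state.\<close>
  have row: "cell_length N x i * (g * h i * dq $ i + H * u i * dq $ (N + 1 + i))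
      = (g * h i * ?s $ i + H * u i * ?s $ (N + 1 + i))
        - (g * U * (h i * Q h i) + g * H * (h i * Q u i + u i * Q h i) + H * U * (u i * Q u i))
        + \<alpha> / 2 * (g * (h i * A h i) + H * (u i * A u i))" if i: "i < N + 1" for i
  proof -
    have "i \<le> N" "i < 2 * (N + 1)" "N + 1 + i < 2 * (N + 1)"
      using i by auto
    note k = kron2_mult_vec_index[OF _ _ _ i]
    have 1: "?s $ i = cell_length N x i * dq $ i + (U * Q h i + H * Q u i) - \<alpha> / 2 * A h i"
      unfolding comp[OF \<open>i < 2 * (N + 1)\<close>] k[OF one_carrier_mat Pmat_carrier dq]
        k[OF Mmat_carrier Qmat_carrier q] k[OF one_carrier_mat Amat_carrier q] M I
        sum_Pmat_row[OF \<open>i \<le> N\<close>]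
      by (simp add: Q_def A_def h_def u_def)
    have 2: "?s $ (N + 1 + i)
        = cell_length N x i * dq $ (N + 1 + i) + (g * Q h i + U * Q u i) - \<alpha> / 2 * A u i"
      unfolding comp[OF \<open>N + 1 + i < 2 * (N + 1)\<close>] k[OF one_carrier_mat Pmat_carrier dq]
        k[OF Mmat_carrier Qmat_carrier q] k[OF one_carrier_mat Amat_carrier q] M I
        sum_Pmat_row[OF \<open>i \<le> N\<close>]
      by (simp add: Q_def A_def h_def u_def)
    show ?thesis
      unfolding 1 2 by (simp add: algebra_simps)
  qed
  have "(\<Sum>i<N + 1. cell_length N x i * (g * h i * dq $ i + H * u i * dq $ (N + 1 + i)))
      = (\<Sum>i<N + 1. g * h i * ?s $ i + H * u i * ?s $ (N + 1 + i))
        - (g * U * B h h + g * H * (B h u + B u h) + H * U * B u u)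
        + \<alpha> / 2 * (g * C h + H * C u)"
    unfolding B_def C_def
    by (subst sum.cong[OF refl row])
      (simp_all only: lessThan_iff sum.distrib sum_subtractf sum_distrib_left[symmetric])
  \<comment> \<open>Symmetry of W M gives both mixed forms the weight \<open>g * H\<close>, so they
    pair up for summation by parts; the unmixed forms are half of their own boundary terms.\<close>
  also have "g * U * B h h + g * H * (B h u + B u h) + H * U * B u u = (?F N - ?F 0) / 2"
  proof -
    have sbp: "B y z + B z y = y N * z N - y 0 * z 0" for y z
      unfolding B_def Q_def by (rule Qmat_summation_by_parts[OF N])
    have "B h h = (h N * h N - h 0 * h 0) / 2" "B u u = (u N * u N - u 0 * u 0) / 2"
      using sbp[of h h] sbp[of u u] by simp_all
    then show ?thesis
      unfolding sbp \<open>B h h = _\<close> \<open>B u u = _\<close>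
      by (simp add: h_def u_def power2_eq_square field_simps)
  qed
  finally have balance: "(\<Sum>i<N + 1. cell_length N x i * (g * h i * dq $ i + H * u i * dq $ (N + 1 + i)))
      = ((?F 0 - ?F N) / 2 + (\<Sum>i<N + 1. g * h i * ?s $ i + H * u i * ?s $ (N + 1 + i)))
        + \<alpha> / 2 * (g * C h + H * C u)"
    by (simp add: field_simps)
  have "C y \<le> 0" for y
    unfolding C_def A_def by (rule Amat_form_nonpos[OF N])
  then have "\<alpha> / 2 * (g * C h + H * C u) \<le> 0"
    using gH(1,2) \<open>\<alpha> \<ge> 0\<close> by (simp add: mult_nonneg_nonpos add_nonpos_nonpos)
  then show ?thesis
    using balance boundary_terms_nonpos[OF gH penalty, where q = q and N = N]
    unfolding h_def u_def by linarith
qed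

theorem theorem11:
  fixes g H U \<alpha> \<tau>01 \<tau>02 \<tau>N1 \<tau>N2 :: real
    and N :: nat and x :: "nat \<Rightarrow> real"
    and q dq :: "real \<Rightarrow> real vec"
  assumes "g > 0" and "H > 0" and "U\<^sup>2 = g * H" and "\<alpha> \<ge> 0"
    and "is_grid N x"
    and "\<And>t. t \<ge> 0 \<Longrightarrow> q t \<in> carrier_vec (2 * (N + 1))"
    and "\<And>t. t \<ge> 0 \<Longrightarrow> has_vec_deriv q (dq t) (2 * (N + 1)) (at t within {0..})"
    and "\<And>t. t \<ge> 0 \<Longrightarrow>
           kron (1\<^sub>m 2) (Pmat N x) *\<^sub>v dq t
           + kron (Mmat g H U) (Qmat N) *\<^sub>v q t
           - (\<alpha> / 2) \<cdot>\<^sub>v (kron (1\<^sub>m 2) (Amat N) *\<^sub>v q t)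
           = SAT g H U N \<tau>01 \<tau>02 \<tau>N1 \<tau>N2 (q t)"
    and "U > 0 \<Longrightarrow> \<tau>01 \<ge> lambda1 g H U \<and> \<tau>02 = 0"
    and "U < 0 \<Longrightarrow> \<tau>N1 = 0 \<and> \<tau>N2 \<ge> - lambda2 g H U"
  shows "\<forall>t\<ge>0. \<exists>D. ((\<lambda>s. WP_norm_sq g H N x (q s)) has_real_derivative D) (at t within {0..})
                 \<and> 1 / 2 * D \<le> 0"
proof (intro allI impI)
  fix t :: real
  assume t: "t \<ge> 0"
  let ?R = "\<Sum>i<N + 1. cell_length N x i * (g * q t $ i * dq t $ i + H * q t $ (N + 1 + i) * dq t $ (N + 1 + i))"
  have deriv: "((\<lambda>s. q s $ k) has_real_derivative dq t $ k) (at t within {0..})"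
    if "k < 2 * (N + 1)" for k
    using assms(7)[OF t] that by (simp add: has_vec_deriv_def)
  have "((\<lambda>s. \<Sum>i<N + 1. cell_length N x i * (g * (q s $ i)\<^sup>2 + H * (q s $ (N + 1 + i))\<^sup>2))
      has_real_derivative 2 * ?R) (at t within {0..})"
    unfolding sum_distrib_left
  proof (rule DERIV_sum)
    fix i assume "i \<in> {..<N + 1}"
    then have "i < 2 * (N + 1)" "N + 1 + i < 2 * (N + 1)"
      by auto
    note deriv[OF this(1), derivative_intros] deriv[OF this(2), derivative_intros]
    show "((\<lambda>s. cell_length N x i * (g * (q s $ i)\<^sup>2 + H * (q s $ (N + 1 + i))\<^sup>2))
        has_real_derivative 2 * (cell_length N x i *
          (g * q t $ i * dq t $ i + H * q t $ (N + 1 + i) * dq t $ (N + 1 + i)))) (at t within {0..})"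
      by (rule derivative_eq_intros refl)+ (simp add: algebra_simps)
  qed
  \<comment> \<open>The explicit sum agrees with the norm only where \<open>q s\<close> is known to
    have the right dimension, that is for \<open>s \<ge> 0\<close>; this suffices for the derivative
    within \<open>{0..}\<close>, and the radius 1 is arbitrary.\<close>
  then have "((\<lambda>s. WP_norm_sq g H N x (q s)) has_real_derivative 2 * ?R) (at t within {0..})"
    by (rule has_field_derivative_transform_within[where d = 1])
      (use t in \<open>auto simp: WP_norm_sq_eq[OF assms(6)]\<close>)
  moreover have "?R \<le> 0"
    using assms(5) assms(7)[OF t]
    by (intro energy_rate_nonpos[OF assms(1-4) _ assms(6)[OF t] _ assms(8)[OF t] assms(9,10)])
      (auto simp: is_grid_def has_vec_deriv_def)
  ultimately show "\<exists>D. ((\<lambda>s. WP_norm_sq g H N x (q s)) has_real_derivative D) (at t within {0..})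
      \<and> 1 / 2 * D \<le> 0"
    by (intro exI[of _ "2 * ?R"]) simp
qed

end
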